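(* Let $r$ and $n$ be positive integers with $r+2\le n\le 2r+1$, and let $m=\frac{nr}{2}$ (an integer). Consider all graphs of order $n$, size $m$ and maximum degree at most $r$ (equivalently, all $r$-regular graphs on $n$ vertices). Every such graph $G$ maximizing the number of triangles is the complement of an $(n-r-1)$-regular graph on $n$ vertices that minimizes the number of triangles among all $(n-r-1)$-regular graphs on $n$ vertices. In particular, if $n$ is even, or if $n$ is odd and $n\le r+1+2\lfloor r/3\rfloor$, then the maximum number of triangles equals $\binom{n}{3}-\frac n2\, r(n-1-r)$.
   Context: Graphs are finite and simple; the complement $\overline G$ of $G$ has the same vertex set and $uv\in E(\overline G)$ iff $u\ne v$ and $uv\notin E(G)$. *)

theory Defs
  imports Complex_Main "HOL-Library.Infinite_Typeclass"
begin

record 'a graph =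
  verts :: "'a set"
  edges :: "'a set set"

definition simple_graph :: "'a graph \<Rightarrow> bool" where
  "simple_graph G \<longleftrightarrow> finite (verts G) \<and>
     edges G \<subseteq> {{u, v} | u v. u \<in> verts G \<and> v \<in> verts G \<and> u \<noteq> v}"

definition gorder :: "'a graph \<Rightarrow> nat" where
  "gorder G = card (verts G)"

definition gsize :: "'a graph \<Rightarrow> nat" where
  "gsize G = card (edges G)"

definition degree :: "'a graph \<Rightarrow> 'a \<Rightarrow> nat" where
  "degree G v = card {u \<in> verts G. {u, v} \<in> edges G}"

text \<open>Only meaningful for nonempty vertex sets.\<close>
definition max_degree :: "'a graph \<Rightarrow> nat" where
  "max_degree G = Max (degree G ` verts G)"

definition regular :: "nat \<Rightarrow> 'a graph \<Rightarrow> bool" where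
  "regular k G \<longleftrightarrow> (\<forall>v \<in> verts G. degree G v = k)"

definition complement :: "'a graph \<Rightarrow> 'a graph" where
  "complement G = \<lparr> verts = verts G,
     edges = {{u, v} | u v. u \<in> verts G \<and> v \<in> verts G \<and> u \<noteq> v \<and> {u, v} \<notin> edges G} \<rparr>"

definition triangles :: "'a graph \<Rightarrow> 'a set set" where
  "triangles G = {T. T \<subseteq> verts G \<and> card T = 3 \<and>
     (\<forall>u \<in> T. \<forall>v \<in> T. u \<noteq> v \<longrightarrow> {u, v} \<in> edges G)}"

definition num_triangles :: "'a graph \<Rightarrow> nat" where
  "num_triangles G = card (triangles G)"

text \<open>
  Vertices are drawn from an arbitrary infinite type, so that, for every \<open>n\<close>, each graph of
  order \<open>n\<close> occurs up to isomorphism. The vertex set of a graph may be any finite set of that type.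
\<close>

definition bounded_degree_graphs :: "nat \<Rightarrow> nat \<Rightarrow> nat \<Rightarrow> 'a::infinite graph set" where
  "bounded_degree_graphs n m r =
     {G. simple_graph G \<and> gorder G = n \<and> gsize G = m \<and> max_degree G \<le> r}"

definition regular_graphs :: "nat \<Rightarrow> nat \<Rightarrow> 'a::infinite graph set" where
  "regular_graphs n k = {G. simple_graph G \<and> gorder G = n \<and> regular k G}"

end

theory Submission
  imports Defs
begin

text \<open>
  Counting degrees shows that a graph of maximum degree at most \<open>r\<close> with \<open>nr/2\<close> edges is
  \<open>r\<close>-regular. By Goodman's double count, every vertex triple that is neither a triangle of \<open>G\<close>
  nor one of its complement has exactly two vertices at which an edge meets a non-edge; for
  \<open>r\<close>-regular \<open>G\<close> there are \<open>n r (n - 1 - r)\<close> such incidences in all, so the numbers of triangles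
  of \<open>G\<close> and of its complement have a constant sum. The value of the maximum then follows from the
  existence of a triangle-free \<open>(n - r - 1)\<close>-regular graph on \<open>n\<close> vertices. For even \<open>n\<close> it can be
  taken bipartite. For odd \<open>n\<close> the degree is \<open>2j\<close> with \<open>n \<ge> 5j + 1\<close>: if \<open>n \<ge> 6j - 1\<close>, a circulant
  graph whose differences lie in the middle third works, and otherwise a graph that maps
  homomorphically to the 5-cycle.
\<close>

section \<open>Degree sums and regularity\<close>

lemma simple_graph_edge:
  assumes "simple_graph G" "{u, v} \<in> edges G"
  shows "u \<in> verts G" "v \<in> verts G" "u \<noteq> v"
  using assms unfolding simple_graph_def by (fastforce simp: doubleton_eq_iff)+

lemma finite_edges:
  assumes "simple_graph G"
  shows "finite (edges G)"
proof -
  have "edges G \<subseteq> Pow (verts G)" "finite (verts G)"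
    using assms unfolding simple_graph_def by auto
  then show ?thesis by (meson finite_Pow_iff finite_subset)
qed

lemma sum_degree:
  assumes "simple_graph G"
  shows "(\<Sum>v\<in>verts G. degree G v) = 2 * gsize G"
proof -
  have fin: "finite (verts G)" using assms by (simp add: simple_graph_def)
  have edge: "\<exists>a b. e = {a, b} \<and> a \<in> verts G \<and> b \<in> verts G \<and> a \<noteq> b" if "e \<in> edges G" for e
    using assms that unfolding simple_graph_def by blast
  have deg: "degree G v = card {e \<in> edges G. v \<in> e}" for v
  proof -
    have "bij_betw (\<lambda>u. {u, v}) {u \<in> verts G. {u, v} \<in> edges G} {e \<in> edges G. v \<in> e}"
      unfolding bij_betw_def
    proof
      show "inj_on (\<lambda>u. {u, v}) {u \<in> verts G. {u, v} \<in> edges G}"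
        by (auto simp: inj_on_def doubleton_eq_iff)
      show "(\<lambda>u. {u, v}) ` {u \<in> verts G. {u, v} \<in> edges G} = {e \<in> edges G. v \<in> e}"
        using edge by (force simp: insert_commute)
    qed
    then show ?thesis unfolding degree_def by (rule bij_betw_same_card)
  qed
  have two: "card {v \<in> verts G. v \<in> e} = 2" if e: "e \<in> edges G" for e
  proof -
    obtain a b where "e = {a, b}" "a \<in> verts G" "b \<in> verts G" "a \<noteq> b" using edge[OF e] by blast
    then have "{v \<in> verts G. v \<in> e} = {a, b}" by auto
    with \<open>a \<noteq> b\<close> show ?thesis by simp
  qed
  have "(\<Sum>v\<in>verts G. degree G v) = (\<Sum>v\<in>verts G. \<Sum>e\<in>edges G. if v \<in> e then 1 else 0)"
    using finite_edges[OF assms] by (simp add: deg sum.If_cases Int_def)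
  also have "\<dots> = (\<Sum>e\<in>edges G. \<Sum>v\<in>verts G. if v \<in> e then 1 else 0)"
    by (rule sum.swap)
  also have "\<dots> = (\<Sum>e\<in>edges G. 2)"
    using fin two by (intro sum.cong) (simp_all add: sum.If_cases Int_def)
  finally show ?thesis by (simp add: gsize_def)
qed

text \<open>The degrees sum to \<open>2 * m = n * r\<close>, so their average is \<open>r\<close>; a
  maximum of at most \<open>r\<close> then forces every degree to equal \<open>r\<close>. Since
  \<open>0 < n\<close>, \<open>max_degree\<close> is taken over a nonempty set.\<close>

lemma bounded_degree_graphs_eq_regular_graphs:
  assumes "0 < n" "2 * m = n * r"
  shows "bounded_degree_graphs n m r = regular_graphs n r"
proof (intro set_eqI iffI)
  fix G :: "'a::infinite graph"
  assume "G \<in> bounded_degree_graphs n m r"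
  then have s: "simple_graph G" and o: "card (verts G) = n" and m: "gsize G = m"
    and d: "max_degree G \<le> r"
    by (auto simp: bounded_degree_graphs_def gorder_def)
  have fin: "finite (verts G)" using s by (simp add: simple_graph_def)
  have le: "degree G v \<le> r" if "v \<in> verts G" for v
    using d that fin unfolding max_degree_def
    by (meson Max_ge finite_imageI imageI le_trans)
  have "degree G v = r" if v: "v \<in> verts G" for v
  proof (rule ccontr)
    assume "degree G v \<noteq> r"
    then have "degree G v < r" using le[OF v] by simp
    then have "(\<Sum>v\<in>verts G. degree G v) < (\<Sum>v\<in>verts G. r)"
      using fin v le by (intro sum_strict_mono_ex1) auto
    then show False using sum_degree[OF s] assms m o by simp
  qed
  then show "G \<in> regular_graphs n r"
    using s o by (auto simp: regular_graphs_def regular_def gorder_def)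
next
  fix G :: "'a::infinite graph"
  assume "G \<in> regular_graphs n r"
  then have s: "simple_graph G" and o: "card (verts G) = n"
    and d: "\<And>v. v \<in> verts G \<Longrightarrow> degree G v = r"
    by (auto simp: regular_graphs_def regular_def gorder_def)
  have "verts G \<noteq> {}" using o assms by auto
  then have "degree G ` verts G = {r}" using d by auto
  then have "max_degree G = r" by (simp add: max_degree_def)
  moreover have "gsize G = m" using sum_degree[OF s] d o assms by simp
  ultimately show "G \<in> bounded_degree_graphs n m r"
    using s o by (simp add: bounded_degree_graphs_def gorder_def)
qed

section \<open>Complements of regular graphs\<close>

lemma verts_complement [simp]: "verts (complement G) = verts G"
  by (simp add: complement_def)

lemma edge_complement_iff:
  "{u, v} \<in> edges (complement G) \<longleftrightarrow>
     u \<in> verts G \<and> v \<in> verts G \<and> u \<noteq> v \<and> {u, v} \<notin> edges G"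
  by (auto simp: complement_def doubleton_eq_iff insert_commute)

lemma simple_graph_complement:
  "simple_graph G \<Longrightarrow> simple_graph (complement G)"
  unfolding simple_graph_def complement_def by auto

lemma complement_complement:
  assumes "simple_graph G"
  shows "complement (complement G) = G"
proof -
  have "edges (complement (complement G)) =
      {{u, v} | u v. u \<in> verts G \<and> v \<in> verts G \<and> u \<noteq> v \<and> {u, v} \<in> edges G}"
    unfolding complement_def[of "complement G"] by (auto simp: edge_complement_iff)
  also have "\<dots> = edges G"
    using assms unfolding simple_graph_def by blast
  finally show ?thesis by (simp add: complement_def)
qed

lemma degree_complement:
  assumes "simple_graph G" "v \<in> verts G"
  shows "degree (complement G) v = gorder G - 1 - degree G v"
proof -
  have fin: "finite (verts G)" using assms by (simp add: simple_graph_def)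
  have "{u \<in> verts G. {u, v} \<in> edges (complement G)} =
      (verts G - {v}) - {u \<in> verts G. {u, v} \<in> edges G}"
    using assms by (auto simp: edge_complement_iff)
  moreover have "{u \<in> verts G. {u, v} \<in> edges G} \<subseteq> verts G - {v}"
    using simple_graph_edge(3)[OF assms(1)] by blast
  ultimately show ?thesis using fin assms(2)
    by (simp add: degree_def gorder_def card_Diff_subset finite_subset)
qed

lemma complement_regular_graphs:
  assumes "G \<in> regular_graphs n r"
  shows "complement G \<in> regular_graphs n (n - 1 - r)"
  using assms degree_complement[of G] simple_graph_complement[of G]
  by (auto simp: regular_graphs_def regular_def gorder_def)

section \<open>Goodman's double count\<close>

text \<open>An edge meets a non-edge at \<open>v\<close> inside \<open>T\<close>. Requiring
  \<open>b \<noteq> v\<close> keeps the singleton \<open>{v, v}\<close> from posing as a non-edge;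
  \<open>a \<noteq> b\<close> follows, as only one of the two pairs is an edge.\<close>

definition mixed_at :: "'a graph \<Rightarrow> 'a \<Rightarrow> 'a set \<Rightarrow> bool" where
  "mixed_at G v T \<longleftrightarrow>
     (\<exists>a b. T = {v, a, b} \<and> a \<noteq> v \<and> b \<noteq> v \<and> {a, v} \<in> edges G \<and> {b, v} \<notin> edges G)"

text \<open>Colour the three pairs of \<open>T\<close> as edges and non-edges. If both colours
  occur, one pair differs from the other two: its two endpoints are mixed, and the opposite vertex
  is not.\<close>

lemma card_mixed_at:
  assumes "T \<subseteq> verts G" "card T = 3"
  shows "card {v \<in> T. mixed_at G v T} =
    (if T \<in> triangles G \<or> T \<in> triangles (complement G) then 0 else 2)"
proof -
  obtain a b c where T: "T = {a, b, c}" and ne: "a \<noteq> b" "a \<noteq> c" "b \<noteq> c"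
    using assms(2) by (auto simp: card_3_iff)
  let ?E = "\<lambda>u v. {u, v} \<in> edges G"
  have sym: "?E b a = ?E a b" "?E c a = ?E a c" "?E c b = ?E b c"
    by (simp_all add: insert_commute)
  have mix: "mixed_at G a T \<longleftrightarrow> ?E a b \<noteq> ?E a c"
    "mixed_at G b T \<longleftrightarrow> ?E a b \<noteq> ?E b c"
    "mixed_at G c T \<longleftrightarrow> ?E a c \<noteq> ?E b c"
  proof -
    \<comment> \<open>Stated for arbitrary labels, so that one argument serves all three vertices of
      \<open>T\<close>.\<close>
    have *: "mixed_at G x {x, y, z} \<longleftrightarrow> ?E y x \<noteq> ?E z x"
      if "x \<noteq> y" "x \<noteq> z" "y \<noteq> z" for x y z
    proof
      assume "mixed_at G x {x, y, z}"
      then obtain p q where "{x, y, z} = {x, p, q}" "p \<noteq> x" "q \<noteq> x" "?E p x" "\<not> ?E q x"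
        by (auto simp: mixed_at_def)
      moreover from this have "p \<in> {y, z}" "q \<in> {y, z}" by blast+
      ultimately show "?E y x \<noteq> ?E z x" by auto
    next
      assume "?E y x \<noteq> ?E z x"
      then consider "?E y x" "\<not> ?E z x" | "?E z x" "\<not> ?E y x" by blast
      then show "mixed_at G x {x, y, z}"
      proof cases
        case 1
        then show ?thesis unfolding mixed_at_def
          by (intro exI[of _ y] exI[of _ z]) (use that in auto)
      next
        case 2
        then show ?thesis unfolding mixed_at_def
          by (intro exI[of _ z] exI[of _ y]) (use that in auto)
      qed
    qed
    have "T = {b, a, c}" "T = {c, a, b}" using T by auto
    then show "mixed_at G a T \<longleftrightarrow> ?E a b \<noteq> ?E a c"
      "mixed_at G b T \<longleftrightarrow> ?E a b \<noteq> ?E b c"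
      "mixed_at G c T \<longleftrightarrow> ?E a c \<noteq> ?E b c"
      using *[of a b c] *[of b a c] *[of c a b] ne T sym by auto
  qed
  have tri: "T \<in> triangles G \<longleftrightarrow> ?E a b \<and> ?E a c \<and> ?E b c"
    unfolding triangles_def using assms ne by (auto simp: T sym)
  have cotri: "T \<in> triangles (complement G) \<longleftrightarrow> \<not> ?E a b \<and> \<not> ?E a c \<and> \<not> ?E b c"
    unfolding triangles_def using assms ne by (auto simp: T sym edge_complement_iff)
  have M: "{v \<in> T. mixed_at G v T} =
      (if ?E a b \<noteq> ?E a c then {a} else {}) \<union> (if ?E a b \<noteq> ?E b c then {b} else {}) \<union>
      (if ?E a c \<noteq> ?E b c then {c} else {})"
    using mix T by auto
  show ?thesis unfolding tri cotri M using ne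
    by (cases "?E a b"; cases "?E a c"; cases "?E b c") simp_all
qed

text \<open>A triple mixed at \<open>v\<close> amounts to a choice of one neighbour and one
  non-neighbour of \<open>v\<close>.\<close>

lemma card_triples_mixed_at:
  assumes "simple_graph G" "v \<in> verts G"
  shows "card {T. T \<subseteq> verts G \<and> card T = 3 \<and> v \<in> T \<and> mixed_at G v T} =
    degree G v * (gorder G - 1 - degree G v)"
proof -
  let ?A = "{u \<in> verts G. {u, v} \<in> edges G}"
  let ?B = "{u \<in> verts G. {u, v} \<in> edges (complement G)}"
  have A: "a \<noteq> v" if "a \<in> ?A" for a using simple_graph_edge[OF assms(1)] that by blast
  have "bij_betw (\<lambda>(a, b). {v, a, b}) (?A \<times> ?B)
      {T. T \<subseteq> verts G \<and> card T = 3 \<and> v \<in> T \<and> mixed_at G v T}"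
    unfolding bij_betw_def
  proof
    show "inj_on (\<lambda>(a, b). {v, a, b}) (?A \<times> ?B)"
    proof (rule inj_onI, clarify)
      fix a b a' b'
      assume h: "{a, v} \<in> edges G" "{b, v} \<in> edges (complement G)"
        "{a', v} \<in> edges G" "{b', v} \<in> edges (complement G)" "{v, a, b} = {v, a', b'}"
        "a \<in> verts G" "a' \<in> verts G"
      \<comment> \<open>Neighbours and non-neighbours of \<open>v\<close> are disjoint, so the
        unordered triple reveals which element plays which role.\<close>
      then have n: "a \<noteq> v" "a' \<noteq> v" "b \<noteq> v" "b' \<noteq> v" "a \<noteq> b'" "a' \<noteq> b"
        using A by (auto simp: edge_complement_iff)
      then show "a = a' \<and> b = b'" using h(5) by (metis insertE insertI1 insert_commute singletonD)
    qed
    show "(\<lambda>(a, b). {v, a, b}) ` (?A \<times> ?B) =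
        {T. T \<subseteq> verts G \<and> card T = 3 \<and> v \<in> T \<and> mixed_at G v T}"
    proof (intro set_eqI iffI)
      fix T assume "T \<in> (\<lambda>(a, b). {v, a, b}) ` (?A \<times> ?B)"
      then obtain a b where ab: "a \<in> ?A" "b \<in> ?B" "T = {v, a, b}" by auto
      then have n: "a \<noteq> v" "b \<noteq> v" "a \<noteq> b" "{b, v} \<notin> edges G"
        using A by (auto simp: edge_complement_iff)
      have "mixed_at G v T" unfolding mixed_at_def using ab n by blast
      then show "T \<in> {T. T \<subseteq> verts G \<and> card T = 3 \<and> v \<in> T \<and> mixed_at G v T}"
        using ab n assms(2) by auto
    next
      fix T assume T: "T \<in> {T. T \<subseteq> verts G \<and> card T = 3 \<and> v \<in> T \<and> mixed_at G v T}"
      then obtain a b where ab: "T = {v, a, b}" "a \<noteq> v" "b \<noteq> v"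
        "{a, v} \<in> edges G" "{b, v} \<notin> edges G"
        by (auto simp: mixed_at_def)
      then have "a \<in> ?A" "b \<in> ?B" using T assms(2) by (auto simp: edge_complement_iff)
      then show "T \<in> (\<lambda>(a, b). {v, a, b}) ` (?A \<times> ?B)" using ab(1) by force
    qed
  qed
  then have "card {T. T \<subseteq> verts G \<and> card T = 3 \<and> v \<in> T \<and> mixed_at G v T} = card (?A \<times> ?B)"
    by (rule bij_betw_same_card[symmetric])
  also have "\<dots> = degree G v * degree (complement G) v"
    by (simp add: card_cartesian_product degree_def)
  finally show ?thesis by (simp add: degree_complement assms)
qed

lemma finite_triangles: "simple_graph G \<Longrightarrow> finite (triangles G)"
  by (rule finite_subset[of _ "Pow (verts G)"]) (auto simp: triangles_def simple_graph_def)

text \<open>The pairs of a vertex \<open>v\<close> and a triple mixed at \<open>v\<close> are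
  counted once by vertices and once by triples. Doubling and writing the identity as a sum avoid
  division and truncated subtraction.\<close>

lemma goodman:
  assumes "simple_graph G"
  shows "2 * (num_triangles G + num_triangles (complement G)) +
      (\<Sum>v\<in>verts G. degree G v * (gorder G - 1 - degree G v)) = 2 * (gorder G choose 3)"
proof -
  let ?V = "verts G"
  let ?S = "{T. T \<subseteq> ?V \<and> card T = 3}"
  let ?M = "triangles G \<union> triangles (complement G)"
  have fin: "finite ?V" using assms by (simp add: simple_graph_def)
  have finS: "finite ?S" using fin by simp
  have cS: "card ?S = gorder G choose 3"
    using n_subsets[OF fin] by (simp add: gorder_def)
  have sub: "?M \<subseteq> ?S" by (auto simp: triangles_def)
  have "triangles G \<inter> triangles (complement G) = {}"
  proof -
    have False if "T \<in> triangles G" "T \<in> triangles (complement G)" for T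
    proof -
      have "card T = 3" using that by (simp add: triangles_def)
      then obtain a b where "a \<in> T" "b \<in> T" "a \<noteq> b" by (auto simp: card_3_iff)
      with that show False by (auto simp: triangles_def edge_complement_iff)
    qed
    then show ?thesis by blast
  qed
  then have cM: "card ?M = num_triangles G + num_triangles (complement G)"
    unfolding num_triangles_def
    by (intro card_Un_disjoint finite_triangles simple_graph_complement assms)
  have "(\<Sum>v\<in>?V. degree G v * (gorder G - 1 - degree G v)) =
      (\<Sum>v\<in>?V. \<Sum>T\<in>?S. if v \<in> T \<and> mixed_at G v T then 1 else 0)"
    using finS card_triples_mixed_at[OF assms]
    by (intro sum.cong) (simp_all add: sum.If_cases Int_def conj_assoc)
  also have "\<dots> = (\<Sum>T\<in>?S. \<Sum>v\<in>?V. if v \<in> T \<and> mixed_at G v T then 1 else 0)"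
    by (rule sum.swap)
  also have "\<dots> = (\<Sum>T\<in>?S. if T \<in> ?M then 0 else 2)"
  proof (rule sum.cong)
    fix T assume T: "T \<in> ?S"
    then have "{v \<in> ?V. v \<in> T \<and> mixed_at G v T} = {v \<in> T. mixed_at G v T}" by auto
    then show "(\<Sum>v\<in>?V. if v \<in> T \<and> mixed_at G v T then 1 else 0) = (if T \<in> ?M then 0 else 2 :: nat)"
      using card_mixed_at[of T G] T fin by (simp add: sum.If_cases Int_def)
  qed simp
  also have "\<dots> = 2 * card (?S - ?M)"
    using finS by (simp add: sum.If_cases Diff_eq Collect_disj_eq)
  also have "card (?S - ?M) = (gorder G choose 3) - card ?M"
    using card_Diff_subset[OF finite_subset[OF sub finS] sub] cS by simp
  finally have "(\<Sum>v\<in>?V. degree G v * (gorder G - 1 - degree G v)) =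
      2 * ((gorder G choose 3) - card ?M)" .
  \<comment> \<open>This makes the natural-number subtraction above exact.\<close>
  moreover have "card ?M \<le> gorder G choose 3"
    using card_mono[OF finS sub] cS by simp
  ultimately show ?thesis using cM by simp
qed

text \<open>For fixed \<open>n\<close> and \<open>r\<close> the two triangle counts have a constant
  sum, so having more triangles in \<open>G\<close> means having fewer in its complement.\<close>

lemma goodman_regular:
  assumes "G \<in> regular_graphs n r"
  shows "2 * (num_triangles G + num_triangles (complement G)) + n * (r * (n - 1 - r)) =
      2 * (n choose 3)"
  using goodman[of G] assms by (simp add: regular_graphs_def regular_def gorder_def)

section \<open>Constructions of triangle-free regular graphs\<close>

text \<open>Lets each construction use a convenient concrete vertex type: a bijection carries the
  relation over to a finite subset of the given infinite type.\<close>

lemma triangle_free_regular_graph_from_relation: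
  fixes V :: "'b set" and R :: "'b \<Rightarrow> 'b \<Rightarrow> bool"
  assumes fin: "finite V"
    and sym: "\<And>u v. R u v \<Longrightarrow> R v u"
    and deg: "\<And>v. v \<in> V \<Longrightarrow> card {u \<in> V. R u v} = k"
    and tf: "\<And>u v w. R u v \<Longrightarrow> R v w \<Longrightarrow> R u w \<Longrightarrow> False"
  shows "\<exists>H :: 'a::infinite graph. H \<in> regular_graphs (card V) k \<and> num_triangles H = 0"
proof -
  obtain B :: "'a set" where B: "finite B" "card B = card V"
    using infinite_arbitrarily_large[OF infinite_UNIV] by metis
  obtain h where h: "bij_betw h B V"
    using finite_same_card_bij[OF B(1) fin B(2)] by blast
  define H where "H = \<lparr>verts = B, edges = {{a, b} | a b. a \<in> B \<and> b \<in> B \<and> R (h a) (h b)}\<rparr>"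
  \<comment> \<open>A loop would be a degenerate triangle, with \<open>u\<close>, \<open>v\<close>
    and \<open>w\<close> all equal.\<close>
  have irr: "\<not> R x x" for x using tf by blast
  have E: "{a, b} \<in> edges H \<longleftrightarrow> a \<in> B \<and> b \<in> B \<and> R (h a) (h b)" for a b
    unfolding H_def using sym by (auto simp: doubleton_eq_iff)
  have "degree H v = k" if v: "v \<in> B" for v
  proof -
    have "bij_betw h {u \<in> B. R (h u) (h v)} {u \<in> V. R u (h v)}"
      using h by (rule bij_betw_Collect) simp
    moreover have "h v \<in> V" using h v by (auto simp: bij_betw_def)
    ultimately have "card {u \<in> B. R (h u) (h v)} = k"
      using deg[of "h v"] by (simp add: bij_betw_same_card)
    moreover have "{u \<in> verts H. {u, v} \<in> edges H} = {u \<in> B. R (h u) (h v)}"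
      using E v by (auto simp: H_def)
    ultimately show ?thesis by (simp add: degree_def)
  qed
  moreover have "simple_graph H" using B irr unfolding H_def simple_graph_def by simp blast
  moreover have "triangles H = {}"
  proof -
    have False if T: "T \<in> triangles H" for T
    proof -
      have "card T = 3" using T by (simp add: triangles_def)
      then obtain a b c where "T = {a, b, c}" "a \<noteq> b" "a \<noteq> c" "b \<noteq> c"
        by (auto simp: card_3_iff)
      then have "R (h a) (h b)" "R (h b) (h c)" "R (h a) (h c)"
        using T by (auto simp: triangles_def E)
      then show False by (rule tf)
    qed
    then show ?thesis by blast
  qed
  ultimately have "H \<in> regular_graphs (card V) k \<and> num_triangles H = 0"
    using B by (simp add: regular_graphs_def regular_def gorder_def num_triangles_def H_def)
  then show ?thesis ..
qed

text \<open>Translation by \<open>a\<close> permutes the residues modulo \<open>p\<close>, so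
  exactly \<open>k\<close> of them land below \<open>k\<close>. It yields \<open>k\<close>-regular
  bipartite graphs between two classes of size \<open>p\<close>.\<close>

lemma card_add_mod_less:
  fixes a p k :: nat
  assumes "k \<le> p"
  shows "card {b. b < p \<and> (a + b) mod p < k} = k"
proof (cases "p = 0")
  case False
  have inj: "inj_on (\<lambda>b. (a + b) mod p) {..<p}"
  proof (rule inj_onI)
    fix x y assume xy: "x \<in> {..<p}" "y \<in> {..<p}" "(a + x) mod p = (a + y) mod p"
    have *: "u = w" if "u \<le> w" "w < p" "(a + w) mod p = (a + u) mod p" for u w
    proof -
      have "p dvd w - u" using that mod_eq_dvd_iff_nat[of "a + u" "a + w" p] by simp
      then show ?thesis using that nat_dvd_not_less[of "w - u" p] by fastforce
    qed
    show "x = y"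
    proof (cases "x \<le> y")
      case True
      then show ?thesis by (rule *) (use xy in simp_all)
    next
      case False
      then show ?thesis by (intro *[of y x, symmetric]) (use xy in simp_all)
    qed
  qed
  have "(\<lambda>b. (a + b) mod p) ` {..<p} = {..<p}"
    using False by (intro card_subset_eq) (auto simp: card_image[OF inj])
  then have "bij_betw (\<lambda>b. (a + b) mod p) {..<p} {..<p}"
    using inj by (simp add: bij_betw_def)
  then have "bij_betw (\<lambda>b. (a + b) mod p) {b \<in> {..<p}. (a + b) mod p < k} {c \<in> {..<p}. c < k}"
    by (rule bij_betw_Collect) simp
  then have "card {b \<in> {..<p}. (a + b) mod p < k} = card {c \<in> {..<p}. c < k}"
    by (rule bij_betw_same_card)
  also have "{c \<in> {..<p}. c < k} = {..<k}" using assms by auto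
  finally show ?thesis by simp
qed (use assms in simp)

text \<open>Two copies of the residues modulo \<open>p\<close>, with \<open>a\<close> and
  \<open>b\<close> on opposite sides joined when \<open>a + b\<close> reduces to one of the first
  \<open>k\<close> residues. Using the sum rather than the difference makes the relation
  symmetric.\<close>

lemma triangle_free_regular_bipartite:
  fixes p k :: nat
  assumes "k \<le> p"
  shows "\<exists>H :: 'a::infinite graph. H \<in> regular_graphs (2 * p) k \<and> num_triangles H = 0"
proof -
  define V where "V = (UNIV :: bool set) \<times> {..<p}"
  define R where "R = (\<lambda>(c, a) (d, b). (c::bool) \<noteq> d \<and> (a + b) mod p < k)"
  have deg: "card {u \<in> V. R u v} = k" if "v \<in> V" for v
  proof -
    obtain c a where v: "v = (c, a)" by (cases v)
    have "{u \<in> V. R u v} = {\<not> c} \<times> {b. b < p \<and> (a + b) mod p < k}"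
      by (auto simp: v V_def R_def add.commute)
    then show ?thesis using card_add_mod_less[OF assms] by (simp add: card_cartesian_product)
  qed
  have sym: "R v u" if "R u v" for u v
    using that by (auto simp: R_def add.commute split: prod.splits)
  have tf: False if "R u v" "R v w" "R u w" for u v w
    using that by (auto simp: R_def split: prod.splits)
  have fin: "finite V" and card: "card V = 2 * p" by (simp_all add: V_def card_cartesian_product)
  show ?thesis
    using triangle_free_regular_graph_from_relation[of V R, OF fin sym deg tf] unfolding card .
qed

text \<open>The set \<open>D\<close> of \<open>2 * j\<close> differences is invariant under
  \<open>d \<mapsto> 2 * p + 1 - d\<close>, which gives a circulant graph. Two elements of
  \<open>D\<close> sum to at least \<open>2 * p - 2 * j + 2\<close>, which exceeds the largest
  element \<open>p + j\<close> because \<open>3 * j \<le> p + 1\<close>.\<close>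

lemma triangle_free_regular_circulant:
  fixes p j :: nat
  assumes "0 < j" "3 * j \<le> p + 1"
  shows "\<exists>H :: 'a::infinite graph. H \<in> regular_graphs (2 * p + 1) (2 * j) \<and> num_triangles H = 0"
proof -
  define D where "D = {int p - int j + 1..int p + int j}"
  define R where "R = (\<lambda>u v :: int. \<bar>u - v\<bar> \<in> D)"
  define V where "V = {0..<int (2 * p + 1)}"
  have deg: "card {u \<in> V. R u v} = 2 * j" if v: "v \<in> V" for v
  proof -
    \<comment> \<open>Shifting the neighbours below \<open>v\<close> by one full turn places all
      neighbours in a single interval of \<open>2 * j\<close> consecutive integers.\<close>
    have "bij_betw (\<lambda>u. if v \<le> u then u else u + int (2 * p + 1)) {u \<in> V. R u v}
        {v + int p - int j + 1..v + int p + int j}"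
      by (rule bij_betw_byWitness[where
            f' = "\<lambda>w. if w < int (2 * p + 1) then w else w - int (2 * p + 1)"])
        (use v assms in \<open>auto simp: V_def R_def D_def split: if_splits\<close>)
    then show ?thesis using bij_betw_same_card by fastforce
  qed
  have sym: "R v u" if "R u v" for u v
    using that by (simp add: R_def abs_minus_commute)
  \<comment> \<open>The largest of the three distances is the sum of the other two.\<close>
  have tf: False if "R u v" "R v w" "R u w" for u v w
    using that assms by (auto simp: R_def D_def)
  have fin: "finite V" and card: "card V = 2 * p + 1" by (simp_all add: V_def)
  show ?thesis
    using triangle_free_regular_graph_from_relation[of V R, OF fin sym deg tf] unfolding card .
qed

text \<open>Blow up the 5-cycle into classes 0, 1, 2, 3, 4 of sizes \<open>x\<close>,
  \<open>j\<close>, \<open>z\<close>, \<open>z\<close>, \<open>j\<close>. Consecutive classes are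
  completely joined, except that classes 2 and 3 carry a \<open>j\<close>-regular bipartite
  graph.\<close>

lemma triangle_free_regular_pentagon:
  fixes n j :: nat
  assumes "5 * j \<le> n" "n \<le> 6 * j"
  shows "\<exists>H :: 'a::infinite graph. H \<in> regular_graphs n (2 * j) \<and> num_triangles H = 0"
proof -
  \<comment> \<open>Classes 1 and 4 need \<open>x + z = 2 * j\<close>, and the order requires
    \<open>x + 2 * j + 2 * z = n\<close>; this determines \<open>z\<close> and \<open>x\<close>. The
    bounds on \<open>n\<close> say that \<open>j \<le> z\<close> and that \<open>x\<close> is not
    truncated.\<close>
  define z where "z = n - 4 * j"
  define x where "x = 6 * j - n"
  have jz: "j \<le> z" and xz: "x + z = 2 * j" using assms by (auto simp: z_def x_def)
  define V where
    "V = {0::nat} \<times> {..<x} \<union> {1, 4} \<times> {..<j} \<union> {2, 3} \<times> {..<z}"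
  define S where "S = (\<lambda>(c, a) (d, b). (c, d) \<in> {(0, 1), (1, 2), (3, 4), (4, 0::nat)} \<or>
    c = (2::nat) \<and> d = 3 \<and> (a + b) mod z < j)"
  define R where "R = (\<lambda>u v. S u v \<or> S v u)"
  have deg: "card {u \<in> V. R u v} = 2 * j" if "v \<in> V" for v
  proof -
    obtain c a where v: "v = (c, a)" by (cases v)
    have cV: "c \<in> {0, 1, 2, 3, 4}" using that by (auto simp: v V_def)
    let ?M = "{b. b < z \<and> (a + b) mod z < j}"
    have M: "card ?M = j" using card_add_mod_less[OF jz] .
    have nb: "{u \<in> V. R u (0, a)} = {1} \<times> {..<j} \<union> {4} \<times> {..<j}"
      "{u \<in> V. R u (1, a)} = {0} \<times> {..<x} \<union> {2} \<times> {..<z}"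
      "{u \<in> V. R u (2, a)} = {1} \<times> {..<j} \<union> {3} \<times> ?M"
      "{u \<in> V. R u (3, a)} = {4} \<times> {..<j} \<union> {2} \<times> ?M"
      "{u \<in> V. R u (4, a)} = {0} \<times> {..<x} \<union> {3} \<times> {..<z}"
      unfolding V_def R_def S_def by (auto simp: add.commute)
    have un: "card ({s} \<times> P \<union> {t} \<times> Q) = card P + card Q"
      if "s \<noteq> t" "finite P" "finite Q" for s t :: nat and P Q :: "nat set"
      using that by (subst card_Un_disjoint) (auto simp: card_cartesian_product)
    show ?thesis using cV M xz by (auto simp: v nb nb(2)[simplified] un)
  qed
  have sym: "R v u" if "R u v" for u v
    using that by (auto simp: R_def)
  \<comment> \<open>Adjacent vertices lie in cyclically consecutive classes. No two of these four
    numbers sum to one of them, which excludes triangles.\<close>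
  have diff: "int (fst u) - int (fst v) \<in> {1, -1, 4, -4}" if "R u v" for u v
    using that unfolding R_def S_def by (cases u; cases v) auto
  have tf: False if "R u v" "R v w" "R u w" for u v w
    using diff[OF that(1)] diff[OF that(2)] diff[OF that(3)] by auto
  have fin: "finite V" by (simp add: V_def)
  have card: "card V = n"
  proof -
    have "card V = x + 2 * j + 2 * z"
      unfolding V_def
      by (subst card_Un_disjoint, simp, simp, force)+ (simp add: card_cartesian_product)
    then show ?thesis using assms by (simp add: x_def z_def)
  qed
  show ?thesis
    using triangle_free_regular_graph_from_relation[of V R, OF fin sym deg tf] unfolding card .
qed

section \<open>Extremal graphs and the value of the maximum\<close>

theorem theorem14:
  fixes r n m :: nat
  assumes "0 < r" and "0 < n"
    and "r + 2 \<le> n" and "n \<le> 2 * r + 1"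
    and "real m = real n * real r / 2"
  shows "(bounded_degree_graphs n m r :: 'a::infinite graph set) = regular_graphs n r \<and>
    (\<forall>G :: 'a graph.
       is_arg_max num_triangles (\<lambda>G. G \<in> bounded_degree_graphs n m r) G \<longrightarrow>
       (\<exists>H. is_arg_min num_triangles (\<lambda>H. H \<in> regular_graphs n (n - r - 1)) H \<and>
            G = complement H)) \<and>
    (even n \<or> (odd n \<and> int n \<le> int r + 1 + 2 * \<lfloor>real r / 3\<rfloor>) \<longrightarrow>
       real (Max (num_triangles ` (bounded_degree_graphs n m r :: 'a graph set))) =
         real (n choose 3) - real n / 2 * real r * (real n - 1 - real r))"
proof -
  define k where "k = n - r - 1"
  have "real (2 * m) = real (n * r)" using assms(5) by simp
  then have m2: "2 * m = n * r" by linarith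
  have eq: "bounded_degree_graphs n m r = (regular_graphs n r :: 'a graph set)"
    using bounded_degree_graphs_eq_regular_graphs[OF assms(2) m2] .
  have co: "complement G \<in> regular_graphs n k" "complement (complement G) = G"
    if "G \<in> regular_graphs n r" for G :: "'a graph"
    using complement_regular_graphs[OF that] complement_complement[of G] that
    by (simp_all add: k_def regular_graphs_def)
  \<comment> \<open>With \<open>co\<close>, complementation is a bijection between the
    \<open>r\<close>-regular and the \<open>k\<close>-regular graphs of order
    \<open>n\<close>.\<close>
  have co': "complement H \<in> regular_graphs n r" "complement (complement H) = H"
    if "H \<in> regular_graphs n k" for H :: "'a graph"
  proof -
    have "n - 1 - k = r" using assms(3) by (simp add: k_def)
    then show "complement H \<in> regular_graphs n r" "complement (complement H) = H"
      using complement_regular_graphs[OF that] complement_complement[of H] that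
      by (simp_all add: regular_graphs_def)
  qed
  have gd: "2 * (num_triangles G + num_triangles (complement G)) + n * (r * k) = 2 * (n choose 3)"
    if "G \<in> regular_graphs n r" for G :: "'a graph"
    using goodman_regular[OF that] by (simp add: k_def)
  have ex: "\<exists>H. is_arg_min num_triangles (\<lambda>H. H \<in> regular_graphs n k) H \<and> G = complement H"
    if G: "is_arg_max num_triangles (\<lambda>G. G \<in> regular_graphs n r) G" for G :: "'a graph"
  proof (intro exI conjI)
    have Gr: "G \<in> regular_graphs n r"
      and mx: "\<And>G' :: 'a graph. G' \<in> regular_graphs n r \<Longrightarrow> \<not> num_triangles G < num_triangles G'"
      using G by (auto simp: is_arg_max_def)
    \<comment> \<open>By the constant sum, an \<open>H\<close> beating \<open>complement G\<close>
      would have a complement with more triangles than \<open>G\<close>.\<close>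
    have "\<not> num_triangles H < num_triangles (complement G)" if H: "H \<in> regular_graphs n k" for H :: "'a graph"
      using mx[OF co'(1)[OF H]] gd[OF Gr] gd[OF co'(1)[OF H]] co'(2)[OF H] by simp
    then show "is_arg_min num_triangles (\<lambda>H. H \<in> regular_graphs n k) (complement G)"
      using co(1)[OF Gr] by (auto simp: is_arg_min_def)
    show "G = complement (complement G)" using co(2)[OF Gr] by simp
  qed
  have val: "real (Max (num_triangles ` (regular_graphs n r :: 'a graph set))) =
      real (n choose 3) - real n / 2 * real r * (real n - 1 - real r)"
    if h: "even n \<or> (odd n \<and> int n \<le> int r + 1 + 2 * \<lfloor>real r / 3\<rfloor>)"
  proof -
    have "\<exists>H :: 'a graph. H \<in> regular_graphs n k \<and> num_triangles H = 0"
    proof (cases "even n")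
      case True
      then obtain p where p: "n = 2 * p" by blast
      then have "k \<le> p" using assms by (simp add: k_def)
      then show ?thesis using triangle_free_regular_bipartite p by blast
    next
      case False
      \<comment> \<open>That \<open>m\<close> is an integer forces \<open>r\<close>, and hence
        \<open>k\<close>, to be even when \<open>n\<close> is odd.\<close>
      have "even (n * r)" using m2 by (metis dvd_triv_left)
      then have "even r" using False by simp
      then have "even k" using False assms(3) by (simp add: k_def)
      then obtain j where j: "k = 2 * j" by blast
      have n: "n = r + 1 + 2 * j" using j assms(3) by (simp add: k_def)
      have "\<lfloor>real r / 3\<rfloor> = int (r div 3)"
        using floor_divide_of_nat_eq[of r 3] by simp
      \<comment> \<open>The bound on \<open>n\<close> reads \<open>j \<le> r div 3\<close>.\<close>
      then have "3 * j \<le> r" using h False n by linarith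
      then have n5: "5 * j \<le> n" using n by simp
      have j0: "0 < j" using n assms(3) by simp
      obtain p where p: "n = 2 * p + 1" using False oddE by blast
      show ?thesis
      \<comment> \<open>The condition means \<open>n \<ge> 6 * j - 1\<close>; its failure gives
        \<open>n \<le> 6 * j - 3\<close>, within the range of the pentagon construction.\<close>
      proof (cases "3 * j \<le> p + 1")
        case True
        then show ?thesis using triangle_free_regular_circulant[OF j0] p j by metis
      next
        case False
        then show ?thesis using triangle_free_regular_pentagon[OF n5] p j by simp
      qed
    qed
    then obtain H :: "'a graph" where H: "H \<in> regular_graphs n k" "num_triangles H = 0" by blast
    let ?N = "num_triangles ` (regular_graphs n r :: 'a graph set)"
    let ?t = "num_triangles (complement H)"
    have t: "2 * ?t + n * (r * k) = 2 * (n choose 3)"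
      using gd[OF co'(1)[OF H(1)]] co'(2)[OF H(1)] H(2) by simp
    have le: "a \<le> ?t" if a: "a \<in> ?N" for a
    proof -
      obtain G :: "'a graph" where G: "G \<in> regular_graphs n r" "a = num_triangles G" using a by blast
      show ?thesis using gd[OF G(1), folded t] G(2) by simp
    qed
    \<comment> \<open>There are infinitely many graphs over the infinite vertex type, but the bound
      \<open>?t\<close> makes their set of triangle counts finite, as \<open>Max\<close>
      requires.\<close>
    then have "finite ?N" by (meson finite_nat_set_iff_bounded_le)
    then have "Max ?N = ?t" using le co'(1)[OF H(1)] by (intro Max_eqI) auto
    moreover have "2 * real ?t + real n * (real r * real k) = 2 * real (n choose 3)"
      using arg_cong[OF t, of real] by simp
    moreover have "real k = real n - 1 - real r" using assms(3) by (simp add: k_def)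
    ultimately show ?thesis by (simp add: field_simps)
  qed
  show ?thesis unfolding eq using ex val by (auto simp: k_def)
qed

end
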